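(* Let $c>0$ and let $n$ be a real number with $n>c$. For $t\ge 0$ put $T:=t+ct^2$, $\rho:=\sqrt{n^2+c^2}$ and $R:=\sqrt{16\rho^2T^2+8cT+1}$. Then for all $t\ge 0$, $$S_{n,c}(t)^2 \le \frac{2}{1+4cT+R}\left(\frac{1}{R+4nT}\right)^{n/c}\left(\frac{\rho R+4\rho^2T+c}{\rho+c}\right)^{\rho/c}$$ and $$\frac{2}{1+4cT+R}\left(\frac{1}{R+4nT}\right)^{n/c}\left(\frac{\rho R+4\rho^2T+c}{\rho+c}\right)^{\rho/c}\le \frac{1}{1+4cT}\bigl(1+4(n+c)T\bigr)^{-n/c}\left(1+8\sqrt{n^2+c^2}\,T\right)^{\sqrt{n^2+c^2}/c}.$$ Consequently, for fixed $n$ and $c$, $$S_{n,c}(t)=\mathcal{O}\left(t^{\frac{\sqrt{n^2+c^2}-n-c}{c}}\right),\qquad t\to\infty.$$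
   Context: For real $a$ and integer $k\ge 1$, $\binom{a}{k}:=\frac{a(a-1)\cdots(a-k+1)}{k!}$, and $\binom{a}{0}:=1$. For $c>0$, real $n>c$, integers $k\ge 0$ and $x\in[0,\infty)$, define $$p_{n,k}^{[c]}(x):=\binom{-n/c}{k}(-cx)^k(1+cx)^{-\frac{n}{c}-k}$$ (with $0^0=1$). For each $x$ the sequence $(p_{n,k}^{[c]}(x))_{k\ge 0}$ is a probability distribution. Its index of coincidence is $$S_{n,c}(x):=\sum_{k=0}^\infty \left(p_{n,k}^{[c]}(x)\right)^2,\qquad x\in[0,\infty).$$ *)

theory Defs
  imports "HOL-Analysis.Analysis" "HOL-Library.Landau_Symbols"
begin

text \<open>
  Intended for \<open>c > 0\<close>, \<open>n > c\<close> and \<open>x \<ge> 0\<close>, where the base \<open>1 + c * x\<close> of \<open>powr\<close> is positive.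
\<close>

definition p_basis :: "real \<Rightarrow> real \<Rightarrow> nat \<Rightarrow> real \<Rightarrow> real" where
  "p_basis n c k x = ((- n / c) gchoose k) * (- c * x) ^ k * (1 + c * x) powr (- n / c - real k)"

definition index_coincidence :: "real \<Rightarrow> real \<Rightarrow> real \<Rightarrow> real" where
  "index_coincidence n c x = (\<Sum>k. (p_basis n c k x)\<^sup>2)"

end

theory Submission
  imports Defs
begin

text \<open>
  Put \<open>a = n / c\<close>, \<open>u = c t\<close>, \<open>U = u (1 + u) = c T\<close>, \<open>w = 1 + 2 u\<close>. Then \<open>S = (1 + u)\<^sup>-\<^sup>2\<^sup>a F(u\<^sup>2 / (1 + u)\<^sup>2)\<close>
  with the hypergeometric function \<open>F(z) = \<Sum>k. (-a gchoose k)\<^sup>2 z\<^sup>k\<close>, so \<open>X = - S' / S\<close> solves the Riccati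
  equation \<open>U w X' = U w X\<^sup>2 - m X + 2 a w\<close> with \<open>m = 1 + 4 (a + 1) U\<close>. The discriminant of the right-hand
  side is \<open>R\<^sup>2 = m\<^sup>2 - 8 a U w\<^sup>2\<close>, and its smaller root \<open>r = 4 a w / (m + R)\<close> decreases in \<open>u\<close> from
  \<open>r(0) = X(0) = 2 a\<close>. Since \<open>X\<close> increases wherever it is below \<open>r\<close>, it always stays above \<open>r\<close>.
  The claimed bound is exactly \<open>exp (- 2 \<integral> r)\<close>.
\<close>

section \<open>Squared binomial coefficients: generating function and hypergeometric
  equation\<close>

definition sq_gf :: "real \<Rightarrow> real \<Rightarrow> real" where
  "sq_gf a z = (\<Sum>k. ((- a) gchoose k)\<^sup>2 * z ^ k)"

definition sq_gf' :: "real \<Rightarrow> real \<Rightarrow> real" where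
  "sq_gf' a z = (\<Sum>k. diffs (\<lambda>k. ((- a) gchoose k)\<^sup>2) k * z ^ k)"

definition sq_gf'' :: "real \<Rightarrow> real \<Rightarrow> real" where
  "sq_gf'' a z = (\<Sum>k. diffs (diffs (\<lambda>k. ((- a) gchoose k)\<^sup>2)) k * z ^ k)"

text \<open>Squaring the one-step recurrence removes its sign. The result is the coefficient form of
  the differential equation in \<open>sq_gf_ode\<close>.\<close>

lemma gchoose_sq_rec:
  "(real k + 1)\<^sup>2 * ((- a) gchoose Suc k)\<^sup>2 = (a + real k)\<^sup>2 * ((- a) gchoose k)\<^sup>2"
proof -
  have "(real k + 1) * ((- a) gchoose Suc k) = (- a - real k) * ((- a) gchoose k)"
    using gbinomial_mult_1[of "- a" k] by (simp add: algebra_simps)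
  then have "((real k + 1) * ((- a) gchoose Suc k))\<^sup>2 = ((- a - real k) * ((- a) gchoose k))\<^sup>2"
    by simp
  then show ?thesis
    by (simp add: power_mult_distrib power2_eq_square algebra_simps)
qed

text \<open>With \<open>q = sqrt \<bar>z\<bar>\<close> the absolute values of the terms are the
  squares of those of the binomial series at \<open>q\<close>. That series converges absolutely, so
  its terms eventually lie below 1 and dominate their own squares.\<close>

lemma summable_gchoose_sq:
  fixes a z :: real
  assumes "a > 0" "\<bar>z\<bar> < 1"
  shows "summable (\<lambda>k. ((- a) gchoose k)\<^sup>2 * z ^ k)"
proof -
  define q where "q = sqrt \<bar>z\<bar>"
  have q: "\<bar>q\<bar> < 1" "q\<^sup>2 = \<bar>z\<bar>"
    using assms by (auto simp: q_def)
  have s: "summable (\<lambda>k. norm (((- a) gchoose k) * q ^ k))"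
  proof (rule abs_summable_in_conv_radius)
    show "ereal (norm q) < conv_radius (\<lambda>k. (- a) gchoose k)"
      using q(1) unfolding conv_radius_gchoose by (auto simp: one_ereal_def)
  qed
  have "summable (\<lambda>k. (norm (((- a) gchoose k) * q ^ k))\<^sup>2)"
  proof (rule summable_comparison_test_ev[OF _ s])
    have "(\<lambda>k. norm (((- a) gchoose k) * q ^ k)) \<longlonglongrightarrow> 0"
      using s by (rule summable_LIMSEQ_zero)
    then have "\<forall>\<^sub>F k in sequentially. norm (((- a) gchoose k) * q ^ k) < 1"
      by (rule order_tendstoD) simp
    then show "\<forall>\<^sub>F k in sequentially. norm ((norm (((- a) gchoose k) * q ^ k))\<^sup>2)
        \<le> norm (((- a) gchoose k) * q ^ k)"
    proof eventually_elim
      case (elim k)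
      then show ?case
        using mult_left_le [of "norm (((- a) gchoose k) * q ^ k)" "norm (((- a) gchoose k) * q ^ k)"]
        by (simp add: power2_eq_square)
    qed
  qed
  moreover have "(norm (((- a) gchoose k) * q ^ k))\<^sup>2 = norm (((- a) gchoose k)\<^sup>2 * z ^ k)" for k
    by (simp add: abs_mult power_mult_distrib q(2) power_abs flip: power_mult)
       (simp add: mult.commute[of k] power_mult q(2) power_abs)
  ultimately show ?thesis
    by (simp add: summable_norm_cancel)
qed

lemma summable_diffs_gchoose_sq:
  fixes a z :: real
  assumes "a > 0" "\<bar>z\<bar> < 1"
  shows "summable (\<lambda>k. diffs (\<lambda>k. ((- a) gchoose k)\<^sup>2) k * z ^ k)"
  using assms by (intro termdiff_converges[of z 1] summable_gchoose_sq) auto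

lemma summable_diffs2_gchoose_sq:
  fixes a z :: real
  assumes "a > 0" "\<bar>z\<bar> < 1"
  shows "summable (\<lambda>k. diffs (diffs (\<lambda>k. ((- a) gchoose k)\<^sup>2)) k * z ^ k)"
  using assms by (intro termdiff_converges[of z 1] summable_diffs_gchoose_sq) auto

lemma DERIV_sq_gf:
  assumes "a > 0" "\<bar>z\<bar> < 1"
  shows "(sq_gf a has_real_derivative sq_gf' a z) (at z)"
  unfolding sq_gf_def [abs_def] sq_gf'_def using assms
  by (intro termdiffs_strong'[where K = 1] summable_gchoose_sq) auto

lemma DERIV_sq_gf':
  assumes "a > 0" "\<bar>z\<bar> < 1"
  shows "(sq_gf' a has_real_derivative sq_gf'' a z) (at z)"
  unfolding sq_gf'_def [abs_def] sq_gf''_def using assms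
  by (intro termdiffs_strong'[where K = 1] summable_diffs_gchoose_sq) auto

lemma sq_gf_pos:
  assumes "a > 0" "0 \<le> z" "z < 1"
  shows "sq_gf a z > 0"
proof -
  \<comment> \<open>The term at \<open>k = 0\<close> is 1 and the others are nonnegative.\<close>
  have "(\<Sum>k\<in>{0::nat}. ((- a) gchoose k)\<^sup>2 * z ^ k) \<le> sq_gf a z"
    unfolding sq_gf_def using assms by (intro sum_le_suminf summable_gchoose_sq) auto
  then show ?thesis by simp
qed

lemma sq_gf_0: "sq_gf a 0 = 1"
  unfolding sq_gf_def by (subst suminf_finite[of "{0}"]) auto

text \<open>This is the hypergeometric equation of 2F1(a, a; 1; z). Both sides of
  \<open>gchoose_sq_rec\<close> are summed against \<open>z ^ k\<close> and expressed through
  \<open>sq_gf\<close> and its derivatives.\<close>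

lemma sq_gf_ode:
  assumes "a > 0" "\<bar>z\<bar> < 1"
  shows "z * (1 - z) * sq_gf'' a z = a\<^sup>2 * sq_gf a z - (1 - (2 * a + 1) * z) * sq_gf' a z"
proof -
  define b where "b = (\<lambda>k. ((- a) gchoose k)\<^sup>2)"
  have F: "(\<lambda>k. b k * z ^ k) sums sq_gf a z"
    unfolding sq_gf_def b_def using summable_gchoose_sq[OF assms] by (rule summable_sums)
  have D: "(\<lambda>k. diffs b k * z ^ k) sums sq_gf' a z"
    unfolding sq_gf'_def b_def using summable_diffs_gchoose_sq[OF assms] by (rule summable_sums)
  have D2: "(\<lambda>k. diffs (diffs b) k * z ^ k) sums sq_gf'' a z"
    unfolding sq_gf''_def b_def using summable_diffs2_gchoose_sq[OF assms] by (rule summable_sums)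
  \<comment> \<open>The factor \<open>real k\<close> kills the term at \<open>k = 0\<close>, so
    shifting the index by one leaves no boundary term. The same device gives \<open>zD2\<close> and
    \<open>z2D2\<close>.\<close>
  have zD: "(\<lambda>k. real k * b k * z ^ k) sums (z * sq_gf' a z)"
    using sums_mult[OF D, of z] sums_Suc_iff[of "\<lambda>k. real k * b k * z ^ k"]
    by (simp add: diffs_def mult_ac)
  have zD2: "(\<lambda>k. real k * diffs b k * z ^ k) sums (z * sq_gf'' a z)"
    using sums_mult[OF D2, of z] sums_Suc_iff[of "\<lambda>k. real k * diffs b k * z ^ k"]
    by (simp add: diffs_def mult_ac)
  have "(\<lambda>k. real (Suc k) * real k * b (Suc k) * z ^ Suc k) sums (z * (z * sq_gf'' a z))"
    using sums_mult[OF zD2, of z] by (simp add: diffs_def mult_ac)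
  then have z2D2: "(\<lambda>k. real k * (real k - 1) * b k * z ^ k) sums (z * (z * sq_gf'' a z))"
    using sums_Suc_iff[of "\<lambda>k. real k * (real k - 1) * b k * z ^ k"] by (simp add: mult_ac)
  have "(\<lambda>k. (real k + 1)\<^sup>2 * b (Suc k) * z ^ k) sums (z * sq_gf'' a z + sq_gf' a z)"
    using sums_add[OF zD2 D] by (simp add: diffs_def power2_eq_square algebra_simps)
  \<comment> \<open>The splitting \<open>(a + k)^2 = a^2 + (2 * a + 1) * k + k * (k - 1)\<close>
    reduces this series to \<open>F\<close>, \<open>zD\<close> and \<open>z2D2\<close>.\<close>
  moreover have "(\<lambda>k. (a + real k)\<^sup>2 * b k * z ^ k) sums
      (a\<^sup>2 * sq_gf a z + ((2 * a + 1) * (z * sq_gf' a z) + z * (z * sq_gf'' a z)))"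
    using sums_add[OF sums_mult[OF F, of "a\<^sup>2"] sums_add[OF sums_mult[OF zD, of "2 * a + 1"] z2D2]]
    by (rule back_subst[of "\<lambda>f. f sums _"]) (simp add: fun_eq_iff power2_eq_square algebra_simps)
  ultimately have "z * sq_gf'' a z + sq_gf' a z
      = a\<^sup>2 * sq_gf a z + ((2 * a + 1) * (z * sq_gf' a z) + z * (z * sq_gf'' a z))"
    using gchoose_sq_rec[of _ a] by (simp add: b_def sums_unique2)
  then show ?thesis by (simp add: algebra_simps)
qed


section \<open>The index of coincidence in one variable and its Riccati equation\<close>

definition coinc :: "real \<Rightarrow> real \<Rightarrow> real" where
  "coinc a u = (1 + u) powr (- 2 * a) * sq_gf a ((u / (1 + u))\<^sup>2)"

text \<open>Minus the logarithmic derivative of \<open>coinc a\<close>.\<close>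

definition coinc_decay :: "real \<Rightarrow> real \<Rightarrow> real" where
  "coinc_decay a u = 2 * a / (1 + u) - 2 * u / (1 + u) ^ 3
     * (sq_gf' a ((u / (1 + u))\<^sup>2) / sq_gf a ((u / (1 + u))\<^sup>2))"

lemma ratio_sq_bounds:
  fixes u :: real
  assumes "u \<ge> 0"
  shows "0 \<le> (u / (1 + u))\<^sup>2" "(u / (1 + u))\<^sup>2 < 1" "\<bar>(u / (1 + u))\<^sup>2\<bar> < 1"
proof -
  have "0 \<le> u / (1 + u)" "u / (1 + u) < 1" using assms by auto
  then show "(u / (1 + u))\<^sup>2 < 1"
    unfolding abs_square_less_1 by (metis abs_of_nonneg)
  then show "\<bar>(u / (1 + u))\<^sup>2\<bar> < 1" by simp
qed simp

text \<open>Squaring removes the sign of \<open>(- c * t) ^ k\<close>. The factor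
  \<open>(1 + u) powr (- 2 * a)\<close> is common to all terms, and what remains is the series of
  \<open>sq_gf\<close>.\<close>

lemma index_coincidence_eq_coinc:
  assumes "c > 0" "n > 0" "t \<ge> 0"
  shows "index_coincidence n c t = coinc (n / c) (c * t)"
proof -
  define a u where "a = n / c" and "u = c * t"
  have a: "a > 0" and u: "u \<ge> 0" using assms by (auto simp: a_def u_def)
  have term_eq: "(p_basis n c k t)\<^sup>2 = (1 + u) powr (- 2 * a) * (((- a) gchoose k)\<^sup>2 * ((u / (1 + u))\<^sup>2) ^ k)" for k
  proof -
    have "(1 + u) powr (- a - real k) = (1 + u) powr (- a) / (1 + u) ^ k"
      using u by (simp add: powr_diff powr_realpow)
    moreover have "((1 + u) powr (- a))\<^sup>2 = (1 + u) powr (- 2 * a)"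
      by (simp add: power2_eq_square flip: powr_add)
    ultimately show ?thesis
      by (simp add: p_basis_def a_def u_def power_mult_distrib power_divide power_minus[of "c * t"]
          power_even_eq flip: power_mult)
  qed
  show ?thesis
    unfolding index_coincidence_def term_eq coinc_def sq_gf_def a_def [symmetric] u_def [symmetric]
    by (rule suminf_mult [OF summable_gchoose_sq [OF a ratio_sq_bounds(3) [OF u]]])
qed

lemma coinc_pos: "a > 0 \<Longrightarrow> u \<ge> 0 \<Longrightarrow> coinc a u > 0"
  by (simp add: coinc_def sq_gf_pos ratio_sq_bounds)

lemma coinc_0: "coinc a 0 = 1"
  by (simp add: coinc_def sq_gf_0)

lemma coinc_decay_0: "coinc_decay a 0 = 2 * a"
  by (simp add: coinc_decay_def)

lemma DERIV_ratio_sq: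
  fixes u :: real
  assumes "u \<ge> 0"
  shows "((\<lambda>u. (u / (1 + u))\<^sup>2) has_real_derivative 2 * u / (1 + u) ^ 3) (at u)"
proof -
  have "((\<lambda>u. u / (1 + u)) has_real_derivative 1 / (1 + u)\<^sup>2) (at u)"
    using assms by (auto intro!: derivative_eq_intros simp: power2_eq_square)
  from DERIV_power [OF this, of 2] show ?thesis
    by (rule DERIV_cong) (use assms in \<open>simp add: divide_simps eval_nat_numeral\<close>)
qed

lemma DERIV_sq_gf_ratio:
  assumes "a > 0" "u \<ge> 0"
  shows "((\<lambda>u. sq_gf a ((u / (1 + u))\<^sup>2)) has_real_derivative
      sq_gf' a ((u / (1 + u))\<^sup>2) * (2 * u / (1 + u) ^ 3)) (at u)"
  by (rule DERIV_chain2 [OF DERIV_sq_gf DERIV_ratio_sq]) (use assms ratio_sq_bounds in auto)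

lemma DERIV_sq_gf'_ratio:
  assumes "a > 0" "u \<ge> 0"
  shows "((\<lambda>u. sq_gf' a ((u / (1 + u))\<^sup>2)) has_real_derivative
      sq_gf'' a ((u / (1 + u))\<^sup>2) * (2 * u / (1 + u) ^ 3)) (at u)"
  by (rule DERIV_chain2 [OF DERIV_sq_gf' DERIV_ratio_sq]) (use assms ratio_sq_bounds in auto)

lemma sq_gf_ratio_pos:
  assumes "a > 0" "u \<ge> 0"
  shows "sq_gf a ((u / (1 + u))\<^sup>2) > 0"
  by (rule sq_gf_pos) (use assms ratio_sq_bounds in auto)

lemma isCont_coinc_decay:
  assumes "a > 0" "u \<ge> 0"
  shows "isCont (coinc_decay a) u"
  unfolding coinc_decay_def [abs_def]
  using assms sq_gf_ratio_pos [OF assms]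
  by (intro continuous_intros DERIV_isCont [OF DERIV_sq_gf_ratio] DERIV_isCont [OF DERIV_sq_gf'_ratio]) auto

lemma DERIV_ln_coinc:
  assumes "a > 0" "u \<ge> 0"
  shows "((\<lambda>u. ln (coinc a u)) has_real_derivative - coinc_decay a u) (at u)"
proof -
  note F = DERIV_sq_gf_ratio [OF assms] and pos = sq_gf_ratio_pos [OF assms]
  have "((\<lambda>u. - 2 * a * ln (1 + u) + ln (sq_gf a ((u / (1 + u))\<^sup>2))) has_real_derivative
      - coinc_decay a u) (at u)"
  proof -
    have "((\<lambda>u. - 2 * a * ln (1 + u)) has_real_derivative - (2 * a / (1 + u))) (at u)"
      using assms(2) by (auto intro!: derivative_eq_intros)
    from DERIV_add [OF this DERIV_chain2 [OF DERIV_ln_divide [OF pos] F]] show ?thesis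
      by (simp add: coinc_decay_def mult_ac)
  qed
  \<comment> \<open>The logarithm of the product is split where both factors are positive. This
    holds on a full neighbourhood of \<open>u\<close>, even at \<open>u = 0\<close>, as the
    two-sided derivative requires.\<close>
  moreover have "\<forall>\<^sub>F v in nhds u. ln (coinc a v) = - 2 * a * ln (1 + v) + ln (sq_gf a ((v / (1 + v))\<^sup>2))"
  proof -
    have "\<forall>\<^sub>F v in nhds u. v > - 1"
      using assms(2) by (intro eventually_nhds_in_open [of "{- 1<..}", simplified]) auto
    moreover have "\<forall>\<^sub>F v in nhds u. sq_gf a ((v / (1 + v))\<^sup>2) > 0"
      using order_tendstoD(1) [OF isContD [OF DERIV_isCont [OF F]] pos] pos
      by (simp add: eventually_nhds_conv_at)
    ultimately show ?thesis
      by eventually_elim (simp add: coinc_def ln_mult ln_powr)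
  qed
  ultimately show ?thesis
    by (subst DERIV_cong_ev [OF refl _ refl])
qed

text \<open>The Riccati equation with denominators cleared. Here \<open>e\<close> stands for
  \<open>sq_gf' / sq_gf\<close> divided by \<open>(1 + u)^2\<close>, so that
  \<open>coinc_decay a u = 2 * (a - u * e) / (1 + u)\<close>.\<close>

lemma riccati_polynomial: fixes u a e :: real shows
 "u * (1 + 2 * u) * (- 2 * a - (2 * (1 + u) - 6 * u) * e + 4 * u\<^sup>2 * e\<^sup>2)
      - 4 * u * (a\<^sup>2 - ((1 + u)\<^sup>2 - (2 * a + 1) * u\<^sup>2) * e)
    = 4 * u * (1 + 2 * u) * (a - u * e)\<^sup>2
      - 2 * (1 + 4 * (a + 1) * (u * (1 + u))) * (a - u * e) + 2 * a * (1 + u) * (1 + 2 * u)"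
  by algebra

text \<open>The left-hand side is the derivative of \<open>coinc_decay\<close> after elimination of
  \<open>sq_gf''\<close>, with \<open>E\<close> for \<open>sq_gf' / sq_gf\<close>. Writing
  \<open>E = e * v^2\<close> gives both sides the denominator \<open>u * v^2 * W\<close> and leaves
  \<open>riccati_polynomial\<close>.\<close>

lemma riccati_rational: fixes u v a E :: real assumes "u > 0" and v: "v = 1 + u"
  shows "- 2 * a / v\<^sup>2 - ((2 * v - 6 * u) / v ^ 4 * E + (4 / (v\<^sup>2 * (1 + 2 * u)) *
      (a\<^sup>2 - (1 - (2 * a + 1) * (u\<^sup>2 / v\<^sup>2)) * E) - 4 * u\<^sup>2 / v ^ 6 * E\<^sup>2))
     = (u * v * (1 + 2 * u) * (2 * a / v - 2 * u / v ^ 3 * E)\<^sup>2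
        - (1 + 4 * (a + 1) * (u * v)) * (2 * a / v - 2 * u / v ^ 3 * E) + 2 * a * (1 + 2 * u))
      / (u * v * (1 + 2 * u))" (is "?l = ?r")
proof -
  define e W where "e = E / v\<^sup>2" and W: "W = 1 + 2 * u"
  have pos: "v > 0" "W > 0" using assms W by auto
  have E: "E = e * v\<^sup>2" using pos by (simp add: e_def)
  have "?l = (u * W * (- 2 * a - (2 * v - 6 * u) * e + 4 * u\<^sup>2 * e\<^sup>2) - 4 * u * (a\<^sup>2 - (v\<^sup>2 - (2 * a + 1) * u\<^sup>2) * e)) / (u * v\<^sup>2 * W)"
    unfolding E W[symmetric] using pos assms(1) by (simp add: divide_simps) (simp add: algebra_simps eval_nat_numeral)
  also have "\<dots> = (4 * u * W * (a - u * e)\<^sup>2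
      - 2 * (1 + 4 * (a + 1) * (u * v)) * (a - u * e) + 2 * a * v * W) / (u * v\<^sup>2 * W)"
    unfolding v W riccati_polynomial ..
  also have "\<dots> = ?r"
    unfolding E W[symmetric] using pos assms(1) by (simp add: divide_simps) (simp add: algebra_simps eval_nat_numeral)
  finally show ?thesis .
qed
text \<open>Logarithmic derivatives of solutions of a linear second-order equation satisfy a Riccati
  equation: differentiating \<open>sq_gf' / sq_gf\<close> produces \<open>sq_gf'' / sq_gf\<close>,
  which \<open>sq_gf_ode\<close> eliminates. That equation degenerates at \<open>z = 0\<close>,
  hence \<open>u > 0\<close>.\<close>

lemma DERIV_coinc_decay:
  assumes "a > 0" "u > 0"
  shows "(coinc_decay a has_real_derivative
      (u * (1 + u) * (1 + 2 * u) * (coinc_decay a u)\<^sup>2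
        - (1 + 4 * (a + 1) * (u * (1 + u))) * coinc_decay a u + 2 * a * (1 + 2 * u))
      / (u * (1 + u) * (1 + 2 * u))) (at u)"
proof -
  have u: "u \<ge> 0" using assms by simp
  note z = ratio_sq_bounds [OF u]
  define z where "z = (u / (1 + u))\<^sup>2"
  define E where "E = sq_gf' a z / sq_gf a z"
  \<comment> \<open>The derivative of \<open>sq_gf' / sq_gf\<close> with respect to
    \<open>z\<close>.\<close>
  define E' where "E' = sq_gf'' a z / sq_gf a z - E\<^sup>2"
  note F = DERIV_sq_gf_ratio [OF assms(1) u, folded z_def]
    and D = DERIV_sq_gf'_ratio [OF assms(1) u, folded z_def]
    and pos = sq_gf_ratio_pos [OF assms(1) u, folded z_def]
  have E: "((\<lambda>u. sq_gf' a ((u / (1 + u))\<^sup>2) / sq_gf a ((u / (1 + u))\<^sup>2)) has_real_derivative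
      E' * (2 * u / (1 + u) ^ 3)) (at u)"
    using pos by (intro DERIV_cong [OF DERIV_divide [OF D F]], unfold z_def [symmetric] E'_def E_def)
      (simp_all add: divide_simps, simp add: power2_eq_square algebra_simps)
  have G: "((\<lambda>u. 2 * u / (1 + u) ^ 3) has_real_derivative (2 * (1 + u) - 6 * u) / (1 + u) ^ 4) (at u)"
  proof -
    have M: "((\<lambda>u. 2 * u) has_real_derivative 2) (at u)"
      by (auto intro!: derivative_eq_intros)
    have N: "((\<lambda>u. (1 + u) ^ 3) has_real_derivative 3 * (1 + u)\<^sup>2) (at u)"
      by (auto intro!: derivative_eq_intros)
    show ?thesis
      using u by (intro DERIV_cong [OF DERIV_divide [OF M N]])
        (simp_all add: divide_simps, simp add: algebra_simps eval_nat_numeral)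
  qed
  have H: "((\<lambda>u. 2 * a / (1 + u)) has_real_derivative - 2 * a / (1 + u)\<^sup>2) (at u)"
    using u by (auto intro!: derivative_eq_intros simp: field_simps power2_eq_square)
  have deriv: "(coinc_decay a has_real_derivative - 2 * a / (1 + u)\<^sup>2
      - ((2 * (1 + u) - 6 * u) / (1 + u) ^ 4 * E + E' * (2 * u / (1 + u) ^ 3) * (2 * u / (1 + u) ^ 3))) (at u)"
    unfolding coinc_decay_def [abs_def] E_def z_def
    by (intro DERIV_diff [OF H] DERIV_mult [OF G E, unfolded z_def])
  have ode: "z * (1 - z) * E' = a\<^sup>2 - (1 - (2 * a + 1) * z) * E - z * (1 - z) * E\<^sup>2"
  proof -
    have "z * (1 - z) * (sq_gf'' a z / sq_gf a z) = a\<^sup>2 - (1 - (2 * a + 1) * z) * E"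
      unfolding E_def times_divide_eq_right sq_gf_ode [OF assms(1) z(3) [folded z_def]]
      using pos by (simp add: diff_divide_distrib)
    then show ?thesis
      by (simp add: E'_def right_diff_distrib)
  qed
  define v where "v = 1 + u"
  have v: "v > 0" "u = v - 1" using u by (auto simp: v_def)
  \<comment> \<open>\<open>k\<close> is \<open>z * (1 - z)\<close> in terms of \<open>u\<close> and
    \<open>v\<close>, and \<open>P\<close> is the part of the equation for \<open>E'\<close> that is
    linear in \<open>E\<close>.\<close>
  define P k where "P = a\<^sup>2 - (1 - (2 * a + 1) * (u\<^sup>2 / v\<^sup>2)) * E"
    and "k = u\<^sup>2 * (1 + 2 * u) / v ^ 4"
  have k: "k \<noteq> 0" using v(1) u assms(2) by (simp add: k_def)
  have "z = u\<^sup>2 / v\<^sup>2" by (simp add: z_def v_def power_divide)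
  moreover have "1 - u\<^sup>2 / v\<^sup>2 = (1 + 2 * u) / v\<^sup>2"
    using v(1) by (simp add: field_simps) (simp add: v_def power2_eq_square algebra_simps)
  ultimately have "z * (1 - z) = k"
    by (simp add: k_def eval_nat_numeral)
  then have "k * E' = P - k * E\<^sup>2"
    using ode \<open>z = u\<^sup>2 / v\<^sup>2\<close> by (simp add: P_def)
  then have E': "E' = P / k - E\<^sup>2"
    using k by (simp add: divide_simps) (simp add: mult_ac)
  have "E' * (2 * u / v ^ 3) * (2 * u / v ^ 3) = 4 / (v\<^sup>2 * (1 + 2 * u)) * P - 4 * u\<^sup>2 / v ^ 6 * E\<^sup>2"
    unfolding E' using v(1) assms(2) by (simp add: k_def divide_simps) (simp add: algebra_simps eval_nat_numeral)
  note E'_eq = this [unfolded P_def]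
  have X: "coinc_decay a u = 2 * a / v - 2 * u / v ^ 3 * E"
    by (simp add: coinc_decay_def v_def E_def z_def)
  have "- 2 * a / v\<^sup>2 - ((2 * v - 6 * u) / v ^ 4 * E + E' * (2 * u / v ^ 3) * (2 * u / v ^ 3))
     = (u * v * (1 + 2 * u) * (coinc_decay a u)\<^sup>2
        - (1 + 4 * (a + 1) * (u * v)) * coinc_decay a u + 2 * a * (1 + 2 * u))
      / (u * v * (1 + 2 * u))"
    unfolding E'_eq X by (rule riccati_rational [OF assms(2) v_def])
  with deriv show ?thesis by (simp add: v_def)
qed


section \<open>The discriminant and the smaller root of the Riccati quadratic\<close>

definition disc_root :: "real \<Rightarrow> real \<Rightarrow> real" where
  "disc_root a U = sqrt (16 * (a\<^sup>2 + 1) * U\<^sup>2 + 8 * U + 1)"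

lemma disc_root_sq: "U \<ge> 0 \<Longrightarrow> (disc_root a U)\<^sup>2 = 16 * (a\<^sup>2 + 1) * U\<^sup>2 + 8 * U + 1"
  by (simp add: disc_root_def)

lemma disc_root_ge: "U \<ge> 0 \<Longrightarrow> disc_root a U \<ge> 1 + 4 * U"
  unfolding disc_root_def by (rule real_le_rsqrt) (simp add: power2_eq_square algebra_simps)

lemma disc_root_pos: "U \<ge> 0 \<Longrightarrow> disc_root a U > 0"
  using disc_root_ge [of U a] by simp

text \<open>With \<open>s = sqrt (a^2 + 1)\<close>, the radicand falls short of the square of the
  right-hand side by \<open>8 * (s - 1) * U\<close>, and \<open>s \<ge> 1\<close>.\<close>

lemma disc_root_le:
  assumes "U \<ge> 0"
  shows "disc_root a U \<le> 1 + 4 * sqrt (a\<^sup>2 + 1) * U"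
  unfolding disc_root_def
proof (rule real_le_lsqrt)
  have "1 \<le> sqrt (a\<^sup>2 + 1)" by simp
  then have "U * 1 \<le> U * sqrt (a\<^sup>2 + 1)" using assms by (intro mult_left_mono)
  moreover have "(1 + 4 * sqrt (a\<^sup>2 + 1) * U)\<^sup>2 = 1 + 8 * (U * sqrt (a\<^sup>2 + 1)) + 16 * (sqrt (a\<^sup>2 + 1))\<^sup>2 * U\<^sup>2"
    by (simp add: power2_sum power_mult_distrib algebra_simps del: real_sqrt_pow2_iff real_sqrt_pow2)
  ultimately show "16 * (a\<^sup>2 + 1) * U\<^sup>2 + 8 * U + 1 \<le> (1 + 4 * sqrt (a\<^sup>2 + 1) * U)\<^sup>2"
    by simp
qed (use assms in auto)

text \<open>
  The smaller root of the quadratic on the right-hand side of the Riccati equation, rationalised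
  so that it also makes sense at \<open>u = 0\<close>.
\<close>

definition decay_bound :: "real \<Rightarrow> real \<Rightarrow> real" where
  "decay_bound a u = 4 * a * (1 + 2 * u)
     / (1 + 4 * (a + 1) * (u * (1 + u)) + disc_root a (u * (1 + u)))"

lemma decay_bound_0: "decay_bound a 0 = 2 * a"
  by (simp add: decay_bound_def disc_root_def)

lemma decay_bound_antimono:
  assumes "a > 0" "0 \<le> u" "u \<le> v"
  shows "decay_bound a v \<le> decay_bound a u"
proof -
  define m where "m u = 1 + 4 * (a + 1) * (u * (1 + u))" for u
  define R where "R u = disc_root a (u * (1 + u))" for u
  \<comment> \<open>Both \<open>m / w\<close> and \<open>R / w\<close> increase with \<open>w = 1 + 2 * u\<close>.\<close>
  define p q where "p = 1 + 2 * u" and "q = 1 + 2 * v"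
  have pq: "1 \<le> p" "p \<le> q" using assms by (auto simp: p_def q_def)
  have "1 * 1 \<le> p * q" using pq by (intro mult_mono) auto
  have R_pos: "R x > 0" if "x \<ge> 0" for x
  proof -
    have "x * (1 + x) \<ge> 0" using that by simp
    from disc_root_ge [OF this, of a] this show ?thesis by (simp add: R_def)
  qed
  have m_pos: "m x > 0" if "x \<ge> 0" for x
    using that assms(1) by (simp add: m_def add_pos_nonneg)
  \<comment> \<open>Since \<open>4 * U = w^2 - 1\<close>, both \<open>m\<close> and the square of
    \<open>R\<close> are polynomials in \<open>w^2\<close>.\<close>
  have R_sq: "(R x)\<^sup>2 = (a\<^sup>2 + 1) * (1 + 2 * x) ^ 4 - 2 * a\<^sup>2 * (1 + 2 * x)\<^sup>2 + a\<^sup>2" if "x \<ge> 0" for x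
    using that by (simp add: R_def disc_root_sq) algebra
  have "p * m v - q * m u = (q - p) * ((a + 1) * (p * q) + a)"
    unfolding m_def p_def q_def by algebra
  moreover have "\<dots> \<ge> 0" using pq assms(1) \<open>1 * 1 \<le> p * q\<close> by (intro mult_nonneg_nonneg) auto
  ultimately have "q * m u \<le> p * m v" by simp
  moreover
  have Ru: "(R u)\<^sup>2 = (a\<^sup>2 + 1) * p ^ 4 - 2 * a\<^sup>2 * p\<^sup>2 + a\<^sup>2"
    and Rv: "(R v)\<^sup>2 = (a\<^sup>2 + 1) * q ^ 4 - 2 * a\<^sup>2 * q\<^sup>2 + a\<^sup>2"
    using R_sq assms by (auto simp: p_def q_def)
  \<comment> \<open>Monotonicity of \<open>R / w\<close>, cross-multiplied and squared. The
    difference factors, and \<open>p * q \<ge> 1\<close> makes the second factor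
    nonnegative.\<close>
  have "q * R u \<le> p * R v"
  proof (rule power2_le_imp_le)
    have "(p * R v)\<^sup>2 - (q * R u)\<^sup>2 = (q\<^sup>2 - p\<^sup>2) * ((a\<^sup>2 + 1) * (p * q)\<^sup>2 - a\<^sup>2)"
      unfolding power_mult_distrib Ru Rv by algebra
    moreover have "\<dots> \<ge> 0"
    proof (intro mult_nonneg_nonneg)
      show "0 \<le> q\<^sup>2 - p\<^sup>2" using pq by simp
      have "1 \<le> (p * q)\<^sup>2" using \<open>1 * 1 \<le> p * q\<close> by simp
      then have "(a\<^sup>2 + 1) * 1 \<le> (a\<^sup>2 + 1) * (p * q)\<^sup>2" by (intro mult_left_mono) auto
      then show "0 \<le> (a\<^sup>2 + 1) * (p * q)\<^sup>2 - a\<^sup>2" by simp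
    qed
    ultimately show "(q * R u)\<^sup>2 \<le> (p * R v)\<^sup>2" by simp
  qed (use pq R_pos [of v] assms in auto)
  ultimately have "q * (m u + R u) \<le> p * (m v + R v)" by (simp add: algebra_simps)
  then have "q / (m v + R v) \<le> p / (m u + R u)"
    using m_pos [of u] m_pos [of v] R_pos [of u] R_pos [of v] assms by (simp add: divide_simps)
  then have "4 * a * (q / (m v + R v)) \<le> 4 * a * (p / (m u + R u))"
    using assms(1) by (intro mult_left_mono) auto
  then show ?thesis
    by (simp add: decay_bound_def m_def R_def p_def q_def)
qed

text \<open>A quadratic with positive leading coefficient is nonnegative up to its smaller root. The
  identity \<open>m^2 - R^2 = 8 * a * U * w^2\<close> turns the rationalised root into
  \<open>(m - R) / (2 * U * w)\<close>; then \<open>m - 2 * U * w * X \<ge> R\<close>, and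
  completing the square concludes.\<close>

lemma riccati_rhs_nonneg:
  assumes "a > 0" "u > 0" "X \<le> decay_bound a u"
  shows "0 \<le> u * (1 + u) * (1 + 2 * u) * X\<^sup>2
    - (1 + 4 * (a + 1) * (u * (1 + u))) * X + 2 * a * (1 + 2 * u)"
proof -
  define U w m R where "U = u * (1 + u)" and "w = 1 + 2 * u"
    and "m = 1 + 4 * (a + 1) * (u * (1 + u))" and "R = disc_root a (u * (1 + u))"
  have U: "U > 0" and w: "w > 0" "w\<^sup>2 = 1 + 4 * U"
    using assms by (simp add: U_def, simp add: w_def)
      (simp add: U_def w_def power2_eq_square algebra_simps)
  have R: "R > 0" using disc_root_ge [of U a] U by (simp add: R_def U_def [symmetric])
  have m: "m = 1 + 4 * (a + 1) * U" "m > 0"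
    using assms U by (auto simp: m_def U_def add_pos_pos)
  have "R\<^sup>2 = 16 * (a\<^sup>2 + 1) * U\<^sup>2 + 8 * U + 1"
    using U unfolding R_def U_def [symmetric] by (simp add: disc_root_sq)
  then have disc: "m\<^sup>2 - R\<^sup>2 = 8 * a * U * w\<^sup>2"
    unfolding m(1) w(2) by algebra
  have "X \<le> 4 * a * w / (m + R)"
    using assms(3) by (simp add: decay_bound_def w_def m_def R_def)
  then have "X * (m + R) \<le> 4 * a * w" using m R by (simp add: pos_le_divide_eq)
  then have "2 * U * w * (X * (m + R)) \<le> 2 * U * w * (4 * a * w)"
    using U w by (intro mult_left_mono) auto
  also have "\<dots> = (m - R) * (m + R)"
    using disc by algebra
  finally have "(2 * U * w * X) * (m + R) \<le> (m - R) * (m + R)" by (simp add: mult_ac)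
  then have "2 * U * w * X \<le> m - R" using m R by (simp add: mult_le_cancel_right_pos)
  then have "R\<^sup>2 \<le> (m - 2 * U * w * X)\<^sup>2" using R by (intro power_mono) auto
  moreover have "4 * U * w * (U * w * X\<^sup>2 - m * X + 2 * a * w) = (m - 2 * U * w * X)\<^sup>2 - R\<^sup>2"
    using disc by algebra
  ultimately have "0 \<le> 4 * U * w * (U * w * X\<^sup>2 - m * X + 2 * a * w)" by simp
  moreover have "0 < 4 * U * w" using U w by simp
  ultimately have "0 \<le> U * w * X\<^sup>2 - m * X + 2 * a * w"
    by (metis mult_le_cancel_left_pos mult_zero_right)
  then show ?thesis by (simp add: U_def w_def m_def)
qed

section \<open>The barrier argument for the logarithmic derivative\<close>

lemma barrier_ge:
  fixes f :: "real \<Rightarrow> real"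
  assumes "0 \<le> b" and cont: "continuous_on {0..b} f" and "\<kappa> \<le> f 0"
    and deriv: "\<And>x. 0 < x \<Longrightarrow> x < b \<Longrightarrow> f x < \<kappa> \<Longrightarrow> \<exists>y. DERIV f x :> y \<and> 0 \<le> y"
  shows "\<kappa> \<le> f b"
proof (rule ccontr)
  assume "\<not> \<kappa> \<le> f b"
  \<comment> \<open>The supremum \<open>v\<close> of \<open>A\<close> is attained, by continuity,
    and is the last point with \<open>f \<ge> \<kappa>\<close>. Beyond it \<open>f\<close> lies
    below \<open>\<kappa>\<close> and hence does not decrease, so
    \<open>f b \<ge> f v \<ge> \<kappa>\<close>.\<close>
  define A where "A = {x \<in> {0..b}. \<kappa> \<le> f x}"
  define v where "v = Sup A"
  have bdd: "bdd_above A" by (auto simp: A_def intro: bdd_aboveI [of _ b])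
  have "closed A"
    unfolding A_def by (intro continuous_on_closed_Collect_le cont continuous_on_const closed_atLeastAtMost)
  moreover have "0 \<in> A" using assms by (simp add: A_def)
  ultimately have "v \<in> A"
    unfolding v_def using bdd by (intro closed_contains_Sup) auto
  then have v: "0 \<le> v" "v \<le> b" "\<kappa> \<le> f v" by (auto simp: A_def)
  have "f v \<le> f b"
  proof (rule DERIV_nonneg_imp_increasing_open [OF v(2)])
    fix x assume x: "v < x" "x < b"
    then have "x \<notin> A" using bdd cSup_upper [of x A] by (auto simp: v_def)
    then show "\<exists>y. DERIV f x :> y \<and> 0 \<le> y"
      using deriv [of x] x v(1) by (auto simp: A_def)
  qed (use v in \<open>auto intro: continuous_on_subset [OF cont]\<close>)
  with v(3) \<open>\<not> \<kappa> \<le> f b\<close> show False by simp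
qed

text \<open>
  As long as \<open>coinc_decay a x\<close> lies below the constant \<open>decay_bound a u\<close>, with \<open>x < u\<close>, it lies below the
  smaller root at \<open>x\<close> and therefore increases; starting from \<open>2 * a\<close> it cannot end up below.
\<close>

lemma decay_bound_le_coinc_decay:
  assumes "a > 0" "u \<ge> 0"
  shows "decay_bound a u \<le> coinc_decay a u"
proof (rule barrier_ge [OF assms(2)])
  show "continuous_on {0..u} (coinc_decay a)"
    by (intro continuous_at_imp_continuous_on) (auto intro: isCont_coinc_decay assms)
  show "decay_bound a u \<le> coinc_decay a 0"
    using decay_bound_antimono [of a 0 u] assms by (simp add: decay_bound_0 coinc_decay_0)
next
  fix x assume x: "0 < x" "x < u" "coinc_decay a x < decay_bound a u"
  have "coinc_decay a x \<le> decay_bound a x"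
    using decay_bound_antimono [of a x u] assms x by simp
  from riccati_rhs_nonneg [OF assms(1) x(1) this] DERIV_coinc_decay [OF assms(1) x(1)] x(1)
  show "\<exists>y. DERIV (coinc_decay a) x :> y \<and> 0 \<le> y"
    by (meson divide_nonneg_pos mult_pos_pos add_pos_pos zero_less_one zero_less_numeral)
qed

section \<open>A closed primitive of the smaller root\<close>

lemma DERIV_disc_root:
  assumes "U \<ge> 0"
  shows "(disc_root a has_real_derivative (16 * (a\<^sup>2 + 1) * U + 4) / disc_root a U) (at U)"
proof -
  have "16 * (a\<^sup>2 + 1) * U\<^sup>2 + 8 * U + 1 > 0" using assms by (simp add: add_nonneg_pos)
  then show ?thesis
    unfolding disc_root_def [abs_def]
    by (auto intro!: derivative_eq_intros simp: divide_simps)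
qed

text \<open>The logarithm of the claimed bound, as a function of \<open>U = c * T\<close>. The
  constants 2 and \<open>sqrt (a^2 + 1) + 1\<close> make it vanish at \<open>U = 0\<close>.\<close>

definition ln_coinc_bound :: "real \<Rightarrow> real \<Rightarrow> real" where
  "ln_coinc_bound a U = ln 2 - ln (1 + 4 * U + disc_root a U) - a * ln (disc_root a U + 4 * a * U)
     + sqrt (a\<^sup>2 + 1) * ln ((sqrt (a\<^sup>2 + 1) * disc_root a U + 4 * (a\<^sup>2 + 1) * U + 1) / (sqrt (a\<^sup>2 + 1) + 1))"

text \<open>\<open>R'\<close> is the derivative of \<open>R\<close> in \<open>U\<close>. Everything
  rests on \<open>R^2 = y^2 + 16 * a^2 * U^2\<close> with \<open>y = 1 + 4 * U\<close>: each
  logarithmic derivative simplifies to a quotient with \<open>R\<close> in the denominator, and an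
  identity between \<open>U\<close> and \<open>R\<close> remains.\<close>

lemma log_derivative_identity:
  fixes a U R s :: real
  assumes a: "a > 0" and U: "U \<ge> 0" and R: "R > 0" "R\<^sup>2 = 16 * (a\<^sup>2 + 1) * U\<^sup>2 + 8 * U + 1"
    and s: "s > 0" "s\<^sup>2 = a\<^sup>2 + 1"
  defines "R' \<equiv> (16 * (a\<^sup>2 + 1) * U + 4) / R"
  shows "- ((4 + R') / (1 + 4 * U + R)) - a * ((R' + 4 * a) / (R + 4 * a * U))
      + s * ((s * R' + 4 * (a\<^sup>2 + 1)) / (s * R + 4 * (a\<^sup>2 + 1) * U + 1))
    = - 8 * a / (1 + 4 * (a + 1) * U + R)"
proof -
  define y m where "y = 1 + 4 * U" and "m = 1 + 4 * (a + 1) * U"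
  have y: "y > 0" and m: "m > 0" using a U by (auto simp: y_def m_def add_pos_nonneg)
  have p2: "R + 4 * a * U > 0" and p3: "s * R + 4 * (a\<^sup>2 + 1) * U + 1 > 0"
    using a U R(1) s(1) by (auto intro: add_pos_nonneg add_nonneg_pos add_nonneg_nonneg)
  have first: "(4 + R') / (y + R) = (4 + 16 * a\<^sup>2 * U / (y + R)) / R"
  proof -
    have "4 * R + (16 * (a\<^sup>2 + 1) * U + 4) = 4 * (y + R) + 16 * a\<^sup>2 * U"
      by (simp add: y_def algebra_simps)
    then show ?thesis
      unfolding R'_def using R(1) y by (simp add: divide_simps)
  qed
  have second: "(R' + 4 * a) / (R + 4 * a * U) = 4 * (R + a) / (R * y)"
  proof -
    have "(16 * (a\<^sup>2 + 1) * U + 4 + 4 * a * R) * y = 4 * (R + a) * (R + 4 * a * U)"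
      using R(2) unfolding y_def by algebra
    moreover have "R' + 4 * a = (16 * (a\<^sup>2 + 1) * U + 4 + 4 * a * R) / R"
      using R(1) by (simp add: R'_def field_simps)
    ultimately show ?thesis
      using R(1) y p2 by (simp add: frac_eq_eq)
  qed
  have third: "s * ((s * R' + 4 * (a\<^sup>2 + 1)) / (s * R + 4 * (a\<^sup>2 + 1) * U + 1)) = 4 * (a\<^sup>2 + 1) / R"
  proof -
    have "s * (s * (16 * (a\<^sup>2 + 1) * U + 4) + 4 * (a\<^sup>2 + 1) * R)
        = 4 * (a\<^sup>2 + 1) * (s * R + 4 * (a\<^sup>2 + 1) * U + 1)"
      using s(2) by algebra
    moreover have "s * (s * R' + 4 * (a\<^sup>2 + 1))
        = s * (s * (16 * (a\<^sup>2 + 1) * U + 4) + 4 * (a\<^sup>2 + 1) * R) / R"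
      using R(1) by (simp add: R'_def field_simps)
    ultimately show ?thesis
      using R(1) p3 by simp
  qed
  have "- (4 + 16 * a\<^sup>2 * U / (y + R)) - 4 * a * (R + a) / y + 4 * (a\<^sup>2 + 1) = - 8 * a * R / (m + R)"
  \<comment> \<open>The general case divides by \<open>U\<close>; at \<open>U = 0\<close> one has
    \<open>R = 1\<close>.\<close>
  proof (cases "U = 0")
    case True
    then have "R = 1" using R by (simp add: power2_eq_1_iff)
    then show ?thesis
      using True by (simp add: y_def m_def power2_eq_square algebra_simps)
  next
    case False
    then have U: "U > 0" using U by simp
    \<comment> \<open>Rationalisation: the conjugates \<open>R - y\<close> and \<open>m - R\<close>
      remove \<open>R\<close> from the denominators of the two fractions.\<close>
    have "16 * a\<^sup>2 * U\<^sup>2 = (R - y) * (y + R)"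
      using R(2) unfolding y_def by algebra
    then have 1: "16 * a\<^sup>2 * U / (y + R) = (R - y) / U"
      using U y R(1) by (simp add: frac_eq_eq power2_eq_square)
    have "8 * a * (U * y) = (m - R) * (m + R)"
      using R(2) unfolding y_def m_def by algebra
    then have 2: "8 * a / (m + R) = (m - R) / (U * y)"
      using U y m R(1) by (simp add: frac_eq_eq)
    \<comment> \<open>After multiplication by \<open>U * y\<close> both sides are polynomials in
      \<open>a\<close>, \<open>U\<close> and \<open>R\<close> that agree modulo the relation for
      \<open>R^2\<close>.\<close>
    have "(- 4 - 4 * a * (R + a) / y + 4 * (a\<^sup>2 + 1) - (R - y) / U) * (U * y)
        = - 4 * (U * y) - 4 * a * (R + a) * U + 4 * (a\<^sup>2 + 1) * (U * y) - (R - y) * y"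
      using U y by (simp add: field_simps)
    also have "\<dots> = - R * (m - R)"
      using R(2) unfolding y_def m_def by algebra
    finally have *: "(- 4 - 4 * a * (R + a) / y + 4 * (a\<^sup>2 + 1) - (R - y) / U) * (U * y) = - R * (m - R)" .
    have "- 4 - 4 * a * (R + a) / y + 4 * (a\<^sup>2 + 1) - (R - y) / U = - R * (m - R) / (U * y)"
      by (rule nonzero_eq_divide_eq [THEN iffD2, OF _ *]) (use U y in simp)
    also have "\<dots> = - R * (8 * a / (m + R))" unfolding 2 by simp
    finally have "- 4 - 4 * a * (R + a) / y + 4 * (a\<^sup>2 + 1) - (R - y) / U = - R * (8 * a / (m + R))" .
    then show ?thesis
      unfolding 1 by (simp add: mult_ac)
  qed
  moreover define A B where "A = 4 + 16 * a\<^sup>2 * U / (y + R)" and "B = 4 * a * (R + a) / y"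
  ultimately have "(- A - B + 4 * (a\<^sup>2 + 1)) / R = - 8 * a * R / (m + R) / R"
    by simp
  also have "\<dots> = - 8 * a / (m + R)"
    using R(1) by simp
  finally have "- (A / R) - B / R + 4 * (a\<^sup>2 + 1) / R = - 8 * a / (m + R)"
    by (simp only: diff_divide_distrib add_divide_distrib minus_divide_left)
  moreover have "a * (4 * (R + a) / (R * y)) = B / R"
    by (simp add: B_def mult_ac)
  ultimately have "- ((4 + 16 * a\<^sup>2 * U / (y + R)) / R) - a * (4 * (R + a) / (R * y)) + 4 * (a\<^sup>2 + 1) / R
      = - 8 * a / (m + R)"
    by (simp only: A_def)
  then show ?thesis
    unfolding y_def [symmetric] m_def [symmetric] first second third by simp
qed

lemma DERIV_ln_coinc_bound:
  assumes "a > 0" "U \<ge> 0"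
  shows "(ln_coinc_bound a has_real_derivative - 8 * a / (1 + 4 * (a + 1) * U + disc_root a U)) (at U)"
proof -
  define s R' where "s = sqrt (a\<^sup>2 + 1)" and "R' = (16 * (a\<^sup>2 + 1) * U + 4) / disc_root a U"
  have s: "s > 0" "s\<^sup>2 = a\<^sup>2 + 1" by (auto simp: s_def add_nonneg_pos)
  have R: "disc_root a U > 0" by (rule disc_root_pos [OF assms(2)])
  note R' = DERIV_disc_root [OF assms(2), of a, folded R'_def]
  have p1: "1 + 4 * U + disc_root a U > 0" using assms R by simp
  have p2: "disc_root a U + 4 * a * U > 0" and p3: "s * disc_root a U + 4 * (a\<^sup>2 + 1) * U + 1 > 0"
    using assms R s(1) by (auto intro: add_pos_nonneg add_nonneg_pos add_nonneg_nonneg)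
  have "((\<lambda>U. 1 + 4 * U + disc_root a U) has_real_derivative 4 + R') (at U)"
    by (auto intro!: derivative_eq_intros R')
  from DERIV_chain2 [OF DERIV_ln_divide [OF p1] this]
  have 1: "((\<lambda>U. ln (1 + 4 * U + disc_root a U)) has_real_derivative
      (4 + R') / (1 + 4 * U + disc_root a U)) (at U)"
    by simp
  have "((\<lambda>U. disc_root a U + 4 * a * U) has_real_derivative R' + 4 * a) (at U)"
    by (auto intro!: derivative_eq_intros R')
  from DERIV_chain2 [OF DERIV_ln_divide [OF p2] this]
  have 2: "((\<lambda>U. ln (disc_root a U + 4 * a * U)) has_real_derivative
      (R' + 4 * a) / (disc_root a U + 4 * a * U)) (at U)"
    by simp
  have "((\<lambda>U. (s * disc_root a U + 4 * (a\<^sup>2 + 1) * U + 1) / (s + 1)) has_real_derivative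
      (s * R' + 4 * (a\<^sup>2 + 1)) / (s + 1)) (at U)"
    using s(1) by (intro DERIV_cdivide) (auto intro!: derivative_eq_intros R')
  from DERIV_chain2 [OF DERIV_ln_divide [OF divide_pos_pos [OF p3]] this] s(1) p3
  have 3: "((\<lambda>U. ln ((s * disc_root a U + 4 * (a\<^sup>2 + 1) * U + 1) / (s + 1))) has_real_derivative
      (s * R' + 4 * (a\<^sup>2 + 1)) / (s * disc_root a U + 4 * (a\<^sup>2 + 1) * U + 1)) (at U)"
    by simp
  show ?thesis
    unfolding ln_coinc_bound_def [abs_def] s_def [symmetric]
      log_derivative_identity [OF assms R disc_root_sq [OF assms(2)] s, symmetric, folded R'_def]
    by (rule DERIV_cong [OF DERIV_add [OF DERIV_diff [OF DERIV_diff [OF DERIV_const 1] DERIV_cmult [OF 2]]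
        DERIV_cmult [OF 3]]]) simp
qed

lemma ln_coinc_bound_0: "ln_coinc_bound a 0 = 0"
proof -
  have "sqrt (a\<^sup>2 + 1) + 1 > 0" by (simp add: add_nonneg_pos)
  then show ?thesis by (simp add: ln_coinc_bound_def disc_root_def)
qed

text \<open>The difference of the two sides vanishes at 0. The chain factor \<open>1 + 2 * x\<close>
  turns the derivative of \<open>ln_coinc_bound\<close> into \<open>- 2 * decay_bound a x\<close>,
  so the difference has derivative
  \<open>2 * (decay_bound a x - coinc_decay a x) \<le> 0\<close>.\<close>

lemma ln_coinc_le:
  assumes "a > 0" "u \<ge> 0"
  shows "2 * ln (coinc a u) \<le> ln_coinc_bound a (u * (1 + u))"
proof -
  have "2 * ln (coinc a u) - ln_coinc_bound a (u * (1 + u))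
      \<le> 2 * ln (coinc a 0) - ln_coinc_bound a (0 * (1 + 0))"
  proof (rule DERIV_nonpos_imp_nonincreasing [OF assms(2)])
    fix x :: real assume x: "0 \<le> x" "x \<le> u"
    have q: "((\<lambda>x. x * (1 + x)) has_real_derivative 1 + 2 * x) (at x)"
      by (auto intro!: derivative_eq_intros)
    have "x * (1 + x) \<ge> 0" using x by simp
    note * = DERIV_chain2 [OF DERIV_ln_coinc_bound [OF assms(1) this] q]
    have "((\<lambda>x. 2 * ln (coinc a x) - ln_coinc_bound a (x * (1 + x))) has_real_derivative
        2 * (decay_bound a x - coinc_decay a x)) (at x)"
      by (rule DERIV_cong [OF DERIV_diff [OF DERIV_cmult [OF DERIV_ln_coinc [OF assms(1) x(1)]] *]])
         (simp add: decay_bound_def)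
    then show "\<exists>y. ((\<lambda>x. 2 * ln (coinc a x) - ln_coinc_bound a (x * (1 + x))) has_real_derivative y) (at x) \<and> y \<le> 0"
      using decay_bound_le_coinc_decay [OF assms(1) x(1)] by (intro exI conjI) auto
  qed
  then show ?thesis by (simp add: coinc_0 ln_coinc_bound_0)
qed

section \<open>The explicit bound, its simplification and the decay rate\<close>

definition coinc_bound :: "real \<Rightarrow> real \<Rightarrow> real" where
  "coinc_bound a U = 2 / (1 + 4 * U + disc_root a U) * (1 / (disc_root a U + 4 * a * U)) powr a
     * ((sqrt (a\<^sup>2 + 1) * disc_root a U + 4 * (a\<^sup>2 + 1) * U + 1) / (sqrt (a\<^sup>2 + 1) + 1)) powr sqrt (a\<^sup>2 + 1)"

lemma exp_ln_coinc_bound: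
  assumes "a > 0" "U \<ge> 0"
  shows "exp (ln_coinc_bound a U) = coinc_bound a U"
proof -
  have R: "disc_root a U > 0" by (rule disc_root_pos [OF assms(2)])
  have s: "sqrt (a\<^sup>2 + 1) > 0" by (simp add: add_nonneg_pos)
  have p1: "1 + 4 * U + disc_root a U > 0" using assms R by simp
  have p2: "disc_root a U + 4 * a * U > 0"
    and p3: "sqrt (a\<^sup>2 + 1) * disc_root a U + 4 * (a\<^sup>2 + 1) * U + 1 > 0"
    using assms R s by (auto intro: add_pos_nonneg add_nonneg_pos add_nonneg_nonneg)
  have p4: "(sqrt (a\<^sup>2 + 1) * disc_root a U + 4 * (a\<^sup>2 + 1) * U + 1) / (sqrt (a\<^sup>2 + 1) + 1) > 0"
    by (intro divide_pos_pos p3 add_pos_pos s zero_less_one)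
  have "exp (ln 2 - ln P - a * ln Q + s * ln X) = 2 / P * (1 / Q) powr a * X powr s"
    if "P > 0" "Q > 0" "X > 0" for P Q X s :: real
    using that by (simp add: powr_def ln_div exp_add exp_diff exp_minus divide_simps)
  from this [OF p1 p2 p4] show ?thesis
    by (simp only: ln_coinc_bound_def coinc_bound_def)
qed

lemma coinc_sq_le:
  assumes "a > 0" "u \<ge> 0"
  shows "(coinc a u)\<^sup>2 \<le> coinc_bound a (u * (1 + u))"
proof -
  have "(coinc a u)\<^sup>2 = exp (2 * ln (coinc a u))"
    using coinc_pos [OF assms] by (simp add: exp_double)
  also have "\<dots> \<le> exp (ln_coinc_bound a (u * (1 + u)))"
    using ln_coinc_le [OF assms] by simp
  also have "\<dots> = coinc_bound a (u * (1 + u))"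
    using assms by (intro exp_ln_coinc_bound) auto
  finally show ?thesis .
qed

text \<open>The three factors are estimated separately: \<open>R \<ge> 1 + 4 * U\<close> serves the
  first two, \<open>R \<le> 1 + 4 * s * U\<close> the third.\<close>

lemma coinc_bound_le:
  assumes "a > 0" "U \<ge> 0"
  shows "coinc_bound a U \<le> 1 / (1 + 4 * U) * (1 + 4 * (a + 1) * U) powr (- a)
     * (1 + 8 * sqrt (a\<^sup>2 + 1) * U) powr sqrt (a\<^sup>2 + 1)"
proof -
  define s where "s = sqrt (a\<^sup>2 + 1)"
  define R where "R = disc_root a U"
  have s: "s > 0" "a\<^sup>2 + 1 = s\<^sup>2" by (auto simp: s_def add_nonneg_pos)
  have R: "1 + 4 * U \<le> R" "R \<le> 1 + 4 * s * U" "R > 0"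
    using disc_root_ge disc_root_le disc_root_pos assms(2) by (auto simp: R_def s_def)
  have m: "1 + 4 * (a + 1) * U > 0" using assms by (simp add: add_pos_nonneg)
  have "2 / (1 + 4 * U + R) \<le> 1 / (1 + 4 * U)"
    using R assms by (simp add: divide_simps)
  moreover have "(1 / (R + 4 * a * U)) powr a \<le> (1 + 4 * (a + 1) * U) powr (- a)"
  proof -
    have "1 + 4 * (a + 1) * U \<le> R + 4 * a * U" using R by (simp add: algebra_simps)
    then have "1 / (R + 4 * a * U) \<le> 1 / (1 + 4 * (a + 1) * U)"
      using m by (intro divide_left_mono) auto
    then have "(1 / (R + 4 * a * U)) powr a \<le> (1 / (1 + 4 * (a + 1) * U)) powr a"
      using assms R(3) by (intro powr_mono2) auto
    also have "\<dots> = (1 + 4 * (a + 1) * U) powr (- a)"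
      using m by (simp add: powr_divide powr_minus_divide)
    finally show ?thesis .
  qed
  moreover have "((s * R + 4 * s\<^sup>2 * U + 1) / (s + 1)) powr s \<le> (1 + 8 * s * U) powr s"
  proof (intro powr_mono2)
    have "s * R \<le> s * (1 + 4 * s * U)" using R(2) s(1) by (intro mult_left_mono) auto
    then have "s * R + 4 * s\<^sup>2 * U + 1 \<le> s + 1 + 8 * s * U * s"
      by (simp add: power2_eq_square algebra_simps)
    also have "\<dots> \<le> s + 1 + 8 * s * U * (s + 1)"
      using s(1) assms(2) by (intro add_left_mono mult_left_mono) auto
    finally have "s * R + 4 * s\<^sup>2 * U + 1 \<le> (1 + 8 * s * U) * (s + 1)"
      by (simp add: algebra_simps)
    then show "(s * R + 4 * s\<^sup>2 * U + 1) / (s + 1) \<le> 1 + 8 * s * U"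
      using s(1) by (simp add: pos_divide_le_eq)
  qed (use s R assms in \<open>auto intro!: divide_nonneg_pos add_nonneg_nonneg\<close>)
  ultimately show ?thesis
    unfolding coinc_bound_def R_def [symmetric] s_def [symmetric]
    unfolding s(2)
    using R assms by (intro mult_mono) auto
qed

text \<open>For large \<open>U\<close> the three factors of the simpler bound behave like
  \<open>U\<close> to the powers \<open>- 1\<close>, \<open>- a\<close> and \<open>s\<close>, which
  add up to \<open>e\<close>. Since \<open>U\<close> is at least \<open>u^2\<close>, taking a square
  root gives \<open>u powr e\<close>.\<close>

lemma coinc_le_powr:
  assumes "a > 0"
  obtains C where "\<And>u. u \<ge> 1 \<Longrightarrow> coinc a u \<le> C * u powr (sqrt (a\<^sup>2 + 1) - a - 1)"
proof -
  define s e where "s = sqrt (a\<^sup>2 + 1)" and "e = sqrt (a\<^sup>2 + 1) - a - 1"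
  \<comment> \<open>The constants left when the factors are replaced by pure powers of
    \<open>U\<close>; \<open>U \<ge> 1\<close> gives
    \<open>1 + 8 * s * U \<le> (1 + 8 * s) * U\<close>.\<close>
  define K where "K = 1 / 4 * (4 * (a + 1)) powr (- a) * (1 + 8 * s) powr s"
  have s: "s > 0" by (simp add: s_def add_nonneg_pos)
  have K: "K \<ge> 0" by (simp add: K_def)
  \<comment> \<open>The sign of \<open>e\<close> matters: a nonpositive exponent turns
    \<open>U \<ge> u^2\<close> into an upper bound for \<open>U powr e\<close>.\<close>
  have "sqrt (a\<^sup>2 + 1) \<le> sqrt (a\<^sup>2) + sqrt 1" by (rule sqrt_add_le_add_sqrt) auto
  then have e: "e \<le> 0" using assms by (simp add: e_def)
  have "coinc a u \<le> sqrt K * u powr e" if u: "u \<ge> 1" for u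
  proof (rule power2_le_imp_le)
    define U where "U = u * (1 + u)"
    have U: "U \<ge> u\<^sup>2" "U \<ge> 1"
      using u mult_mono [of 1 u 1 "1 + u"] by (auto simp: U_def power2_eq_square algebra_simps)
    have "(coinc a u)\<^sup>2 \<le> 1 / (1 + 4 * U) * (1 + 4 * (a + 1) * U) powr (- a) * (1 + 8 * s * U) powr s"
      using coinc_sq_le [OF assms, of u] coinc_bound_le [OF assms, of U] u U
      by (simp add: U_def [symmetric] s_def)
    also have "\<dots> \<le> 1 / (4 * U) * (4 * (a + 1) * U) powr (- a) * ((1 + 8 * s) * U) powr s"
    proof (intro mult_mono)
      show "(1 + 4 * (a + 1) * U) powr (- a) \<le> (4 * (a + 1) * U) powr (- a)"
        using assms U by (intro powr_mono2') auto
      show "(1 + 8 * s * U) powr s \<le> ((1 + 8 * s) * U) powr s"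
        using s U by (intro powr_mono2) (auto simp: algebra_simps intro!: add_nonneg_nonneg)
    qed (use U in \<open>auto simp: divide_simps\<close>)
    also have "\<dots> = K * U powr e"
      using U assms s unfolding K_def e_def s_def [symmetric]
      by (simp add: powr_mult powr_diff powr_minus divide_simps)
    also have "\<dots> \<le> K * (u\<^sup>2) powr e"
      using K e U u by (intro mult_left_mono powr_mono2') auto
    also have "\<dots> = (sqrt K * u powr e)\<^sup>2"
      using K u by (simp add: power_mult_distrib power2_eq_square powr_mult)
    finally show "(coinc a u)\<^sup>2 \<le> (sqrt K * u powr e)\<^sup>2" .
  qed (use K in auto)
  then show ?thesis using that unfolding e_def by blast
qed

section \<open>Return to the parameters \<open>n\<close>, \<open>c\<close> and
  \<open>t\<close>\<close>

theorem theorem2p1: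
  fixes n c :: real
  assumes "c > 0" and "n > c"
  shows "(\<forall>t\<ge>0.
           let T = t + c * t\<^sup>2;
               \<rho> = sqrt (n\<^sup>2 + c\<^sup>2);
               R = sqrt (16 * \<rho>\<^sup>2 * T\<^sup>2 + 8 * c * T + 1);
               B = 2 / (1 + 4 * c * T + R) * (1 / (R + 4 * n * T)) powr (n / c)
                     * ((\<rho> * R + 4 * \<rho>\<^sup>2 * T + c) / (\<rho> + c)) powr (\<rho> / c)
           in (index_coincidence n c t)\<^sup>2 \<le> B \<and>
              B \<le> 1 / (1 + 4 * c * T) * (1 + 4 * (n + c) * T) powr (- n / c)
                    * (1 + 8 * sqrt (n\<^sup>2 + c\<^sup>2) * T) powr (sqrt (n\<^sup>2 + c\<^sup>2) / c)) \<and>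
         (\<lambda>t. index_coincidence n c t) \<in> O[at_top](\<lambda>t. t powr ((sqrt (n\<^sup>2 + c\<^sup>2) - n - c) / c))"
proof -
  define a s where "a = n / c" and "s = sqrt (a\<^sup>2 + 1)"
  have a: "a > 0" and n: "n = a * c" "n > 0" using assms by (auto simp: a_def)
  have s: "s > 0" "a\<^sup>2 + 1 = s\<^sup>2" by (auto simp: s_def add_nonneg_pos)
  have \<rho>: "sqrt (n\<^sup>2 + c\<^sup>2) = s * c"
  proof -
    have "n\<^sup>2 + c\<^sup>2 = (s * c)\<^sup>2"
      unfolding n(1) power_mult_distrib s(2) [symmetric] by (simp add: algebra_simps)
    then show ?thesis using s(1) assms(1) by simp
  qed
  have S: "index_coincidence n c t = coinc a (c * t)" if "t \<ge> 0" for t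
    unfolding a_def by (rule index_coincidence_eq_coinc [OF assms(1) n(2) that])
  have bounds: "let T = t + c * t\<^sup>2;
               \<rho> = sqrt (n\<^sup>2 + c\<^sup>2);
               R = sqrt (16 * \<rho>\<^sup>2 * T\<^sup>2 + 8 * c * T + 1);
               B = 2 / (1 + 4 * c * T + R) * (1 / (R + 4 * n * T)) powr (n / c)
                     * ((\<rho> * R + 4 * \<rho>\<^sup>2 * T + c) / (\<rho> + c)) powr (\<rho> / c)
           in (index_coincidence n c t)\<^sup>2 \<le> B \<and>
              B \<le> 1 / (1 + 4 * c * T) * (1 + 4 * (n + c) * T) powr (- n / c)
                    * (1 + 8 * sqrt (n\<^sup>2 + c\<^sup>2) * T) powr (sqrt (n\<^sup>2 + c\<^sup>2) / c)"
    if t: "t \<ge> 0" for t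
  proof -
    define T where "T = t + c * t\<^sup>2"
    \<comment> \<open>The substitution \<open>u = c * t\<close> makes \<open>u * (1 + u)\<close>
      equal to \<open>c * T\<close>; together with \<open>\<rho> = s * c\<close> it matches all
      factors with their one-parameter forms.\<close>
    have U: "c * t * (1 + c * t) = c * T" by (simp add: T_def power2_eq_square algebra_simps)
    have T: "T \<ge> 0" using t assms by (simp add: T_def)
    have R: "sqrt (16 * (s * c)\<^sup>2 * T\<^sup>2 + 8 * c * T + 1) = disc_root a (c * T)"
      by (simp add: disc_root_def s(2) power_mult_distrib mult_ac)
    have frac: "(s * c * disc_root a (c * T) + 4 * (s * c)\<^sup>2 * T + c) / (s * c + c)
        = (s * disc_root a (c * T) + 4 * (a\<^sup>2 + 1) * (c * T) + 1) / (s + 1)"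
    proof -
      have "s * c * disc_root a (c * T) + 4 * (s * c)\<^sup>2 * T + c
          = c * (s * disc_root a (c * T) + 4 * (a\<^sup>2 + 1) * (c * T) + 1)"
        unfolding s(2) by (simp add: power2_eq_square algebra_simps)
      moreover have "s * c + c = c * (s + 1)" by (simp add: algebra_simps)
      ultimately show ?thesis using assms(1) by simp
    qed
    have B: "2 / (1 + 4 * c * T + disc_root a (c * T)) * (1 / (disc_root a (c * T) + 4 * n * T)) powr (n / c)
        * ((s * c * disc_root a (c * T) + 4 * (s * c)\<^sup>2 * T + c) / (s * c + c)) powr (s * c / c)
        = coinc_bound a (c * T)"
      unfolding frac coinc_bound_def s_def [symmetric] using assms(1) by (simp add: n(1) mult_ac)
    have C: "1 / (1 + 4 * c * T) * (1 + 4 * (n + c) * T) powr (- n / c) * (1 + 8 * (s * c) * T) powr (s * c / c)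
        = 1 / (1 + 4 * (c * T)) * (1 + 4 * (a + 1) * (c * T)) powr (- a) * (1 + 8 * s * (c * T)) powr s"
      using assms(1) by (simp add: n(1) algebra_simps)
    have "(index_coincidence n c t)\<^sup>2 \<le> coinc_bound a (c * T)"
      using coinc_sq_le [OF a, of "c * t"] assms t unfolding U S [OF t] by simp
    moreover have "coinc_bound a (c * T)
        \<le> 1 / (1 + 4 * (c * T)) * (1 + 4 * (a + 1) * (c * T)) powr (- a) * (1 + 8 * s * (c * T)) powr s"
      unfolding s_def using assms T by (intro coinc_bound_le [OF a]) simp
    ultimately show ?thesis
      unfolding Let_def T_def [symmetric] \<rho> R B C by blast
  qed
  have "(\<lambda>t. index_coincidence n c t) \<in> O[at_top](\<lambda>t. t powr ((sqrt (n\<^sup>2 + c\<^sup>2) - n - c) / c))"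
  proof -
    define e where "e = s - a - 1"
    have e: "(sqrt (n\<^sup>2 + c\<^sup>2) - n - c) / c = e"
      unfolding \<rho> unfolding n(1) e_def using assms(1) by (simp add: field_simps)
    obtain K where K: "\<And>u. u \<ge> 1 \<Longrightarrow> coinc a u \<le> K * u powr e"
      using coinc_le_powr [OF a] unfolding e_def s_def by blast
    have "\<forall>\<^sub>F t in at_top. norm (index_coincidence n c t) \<le> K * c powr e * norm (t powr e)"
      \<comment> \<open>From \<open>t = 1 / c\<close> on, \<open>u = c * t\<close> is at least 1,
        where \<open>coinc_le_powr\<close> applies; the factor \<open>c powr e\<close> goes into the
        constant.\<close>
      using eventually_ge_at_top [of "1 / c"]
    proof eventually_elim
      case (elim t)
      then have t: "t \<ge> 0" "1 \<le> c * t"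
        using assms(1) by (auto simp: divide_simps mult_ac intro: order_trans [of 0 "1 / c"])
      show ?case
        using K [OF t(2)] coinc_pos [OF a, of "c * t"] t assms(1) by (simp add: S powr_mult mult_ac)
    qed
    then show ?thesis unfolding e by (rule bigoI)
  qed
  with bounds show ?thesis by blast
qed

end
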